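(* Let $B_W>0$, $\delta\in(0,1)$, $W=\{w\in\mathbb R_+^m:\sum_{a\in A}w(s,a)\le B_W\ \forall s\in S\}$, and assume $\min\{|A|,|S|\}>1$. Assume that there are an optimal policy $\pi^*$ (a maximizer of $J_{\mu_0}$) and a constant $C^*>0$ with $\theta_{\pi^*,\mu_0}(s,a)\le C^*\mu(s,a)$ for all $(s,a)\in S\times A$, and that $W$ contains an optimal solution $w^*$ of the linear program $\max_{w\ge0}u^\top w$ s.t. $Kw=(1-\gamma)\mu_0$ with $\pi_{w^*}=\pi^*$. Let $w_{\mathcal D}$ be a solution of $$\max_{w\in W}\ u_{\mathcal D}^\top w\quad\text{s.t.}\quad\|K_{\mathcal D}w-(1-\gamma)\mu_0\|_1\le\frac{2B_W\sqrt{|S|\log((2|A|+2)/\delta)}}{\sqrt n},$$ and let $\pi_{\mathcal D}=\pi_{w_{\mathcal D}}$. Then, with probability at least $1-6\delta$ over the dataset $\mathcal D$, $$J_{\mu_0}(\pi^* )-J_{\mu_0}(\pi_{\mathcal D})\le\frac{4B_W\sqrt{|S|\log((2|A|+2)/\delta)}}{(1-\gamma)\sqrt n}.$$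
   Context: MDP: $S,A$ are finite, $m=|S||A|$, $r:S\times A\to[0,1]$ is the reward, $P_{s,a}\in\Delta(S)$ the transition probabilities, $\gamma\in[0,1)$, $\mu_0\in\Delta(S)$ the initial state distribution. A policy is a map $\pi:S\to\Delta(A)$. For $\rho\in\Delta(S)$ the discounted occupancy measure is $\theta_{\pi,\rho}(s,a)=(1-\gamma)\sum_{t\ge0}\gamma^t\,\mathbb P_\pi(s_t=s,a_t=a;\,s_0\sim\rho)$, and $J_\rho(\pi)=\sum_{s,a}r(s,a)\theta_{\pi,\rho}(s,a)$. Offline data: $\mathcal D=\{(s_i,a_i,s_i',r_i)\}_{i=1}^n$ are i.i.d. with $(s_i,a_i)\sim\mu\in\Delta(S\times A)$, $s_i'\sim P_{s_i,a_i}$, $r_i=r(s_i,a_i)$. Put $\mu(s)=\sum_a\mu(s,a)$, $\pi_\mu(a\mid s)=\mu(s,a)/\mu(s)$ if $\mu(s)>0$ and $\pi_\mu(a\mid s)=0$ for all $a$ otherwise; $\pi_\mu$ is known. Vectors/matrices: $u(s,a)=r(s,a)\mu(s,a)$; $u_{\mathcal D}^\top w=\frac1n\sum_i r_iw(s_i,a_i)$; $(Kw)(s)=\sum_a w(s,a)\mu(s,a)-\gamma\sum_{\bar s,a}P_{\bar s,a}(s)w(\bar s,a)\mu(\bar s,a)$; $(K_{\mathcal D}w)(s)=\frac1n\sum_{i=1}^n w(s_i,a_i)\big(\mathbf 1\{s_i=s\}-\gamma\mathbf 1\{s_i'=s\}\big)$. For $w\in\mathbb R_+^m$: $\pi_w(a\mid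 s)=\frac{w(s,a)\pi_\mu(a\mid s)}{\sum_{a'}w(s,a')\pi_\mu(a'\mid s)}$ if the denominator is positive, and $\pi_w(a\mid s)=1/|A|$ otherwise. *)

theory Defs
  imports "HOL-Probability.Probability"
begin

text \<open>Finite state and action spaces are the finite types \<open>'s\<close> and \<open>'a\<close>. A policy is a stationary
  randomized one, of type \<open>'s \<Rightarrow> 'a pmf\<close>, and a vector of \<open>\<real>\<^sup>m\<close> is a \<open>real ^ ('s \<times> 'a)\<close>.\<close>

text \<open>The law of \<open>(s\<^sub>t, a\<^sub>t)\<close> under a policy, when \<open>s\<^sub>0\<close> is drawn from \<open>\<rho>\<close>.\<close>

primrec step_pmf ::
  "('s \<times> 'a \<Rightarrow> 's pmf) \<Rightarrow> ('s \<Rightarrow> 'a pmf) \<Rightarrow> 's pmf \<Rightarrow> nat \<Rightarrow> ('s \<times> 'a) pmf" where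
  "step_pmf P \<pi> \<rho> 0 = bind_pmf \<rho> (\<lambda>s. map_pmf (Pair s) (\<pi> s))"
| "step_pmf P \<pi> \<rho> (Suc t) =
     bind_pmf (step_pmf P \<pi> \<rho> t) (\<lambda>sa. bind_pmf (P sa) (\<lambda>s'. map_pmf (Pair s') (\<pi> s')))"

definition occupancy ::
  "('s \<times> 'a \<Rightarrow> 's pmf) \<Rightarrow> real \<Rightarrow> ('s \<Rightarrow> 'a pmf) \<Rightarrow> 's pmf \<Rightarrow> 's \<times> 'a \<Rightarrow> real" where
  "occupancy P \<gamma> \<pi> \<rho> sa = (1 - \<gamma>) * (\<Sum>t. \<gamma> ^ t * pmf (step_pmf P \<pi> \<rho> t) sa)"

definition J ::
  "('s::finite \<times> 'a::finite \<Rightarrow> 's pmf) \<Rightarrow> ('s \<times> 'a \<Rightarrow> real) \<Rightarrow> real \<Rightarrow> 's pmf \<Rightarrow> ('s \<Rightarrow> 'a pmf) \<Rightarrow> real" where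
  "J P r \<gamma> \<rho> \<pi> = (\<Sum>sa\<in>UNIV. r sa * occupancy P \<gamma> \<pi> \<rho> sa)"

type_synonym ('s, 'a) dataset = "nat \<Rightarrow> 's \<times> 'a \<times> 's \<times> real"

definition sample_pmf ::
  "('s \<times> 'a \<Rightarrow> 's pmf) \<Rightarrow> ('s \<times> 'a \<Rightarrow> real) \<Rightarrow> ('s \<times> 'a) pmf \<Rightarrow> ('s \<times> 'a \<times> 's \<times> real) pmf" where
  "sample_pmf P r \<mu> = bind_pmf \<mu> (\<lambda>(s, a). map_pmf (\<lambda>s'. (s, a, s', r (s, a))) (P (s, a)))"

text \<open>The samples of a dataset \<open>D\<close> of size \<open>n\<close> are \<open>D 0, \<dots>, D (n - 1)\<close>; they are i.i.d.\<close>

definition dataset_pmf ::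
  "('s \<times> 'a \<Rightarrow> 's pmf) \<Rightarrow> ('s \<times> 'a \<Rightarrow> real) \<Rightarrow> ('s \<times> 'a) pmf \<Rightarrow> nat \<Rightarrow> ('s, 'a) dataset pmf" where
  "dataset_pmf P r \<mu> n = Pi_pmf {..<n} undefined (\<lambda>_. sample_pmf P r \<mu>)"

definition state_marginal :: "('s \<times> 'a::finite) pmf \<Rightarrow> 's \<Rightarrow> real" where
  "state_marginal \<mu> s = (\<Sum>a\<in>UNIV. pmf \<mu> (s, a))"

definition behavior :: "('s \<times> 'a::finite) pmf \<Rightarrow> 's \<Rightarrow> 'a \<Rightarrow> real" where
  "behavior \<mu> s a =
     (if state_marginal \<mu> s > 0 then pmf \<mu> (s, a) / state_marginal \<mu> s else 0)"

definition reward_vec ::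
  "('s::finite \<times> 'a::finite \<Rightarrow> real) \<Rightarrow> ('s \<times> 'a) pmf \<Rightarrow> real ^ ('s \<times> 'a)" where
  "reward_vec r \<mu> = (\<chi> sa. r sa * pmf \<mu> sa)"

definition K_op ::
  "('s::finite \<times> 'a::finite \<Rightarrow> 's pmf) \<Rightarrow> real \<Rightarrow> ('s \<times> 'a) pmf \<Rightarrow> real ^ ('s \<times> 'a) \<Rightarrow> real ^ 's" where
  "K_op P \<gamma> \<mu> w = (\<chi> s. (\<Sum>a\<in>UNIV. w $ (s, a) * pmf \<mu> (s, a))
      - \<gamma> * (\<Sum>(s', a)\<in>UNIV. pmf (P (s', a)) s * w $ (s', a) * pmf \<mu> (s', a)))"

definition emp_reward ::
  "nat \<Rightarrow> ('s::finite, 'a::finite) dataset \<Rightarrow> real ^ ('s \<times> 'a) \<Rightarrow> real" where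
  "emp_reward n D w = 1 / real n * (\<Sum>i<n. case D i of (s, a, s', x) \<Rightarrow> x * w $ (s, a))"

definition emp_K ::
  "real \<Rightarrow> nat \<Rightarrow> ('s::finite, 'a::finite) dataset \<Rightarrow> real ^ ('s \<times> 'a) \<Rightarrow> real ^ 's" where
  "emp_K \<gamma> n D w = (\<chi> s. 1 / real n *
      (\<Sum>i<n. case D i of (s\<^sub>i, a\<^sub>i, s\<^sub>i', x) \<Rightarrow>
         w $ (s\<^sub>i, a\<^sub>i) * (of_bool (s\<^sub>i = s) - \<gamma> * of_bool (s\<^sub>i' = s))))"

definition pmf_vec :: "'s::finite pmf \<Rightarrow> real ^ 's" where
  "pmf_vec \<rho> = (\<chi> s. pmf \<rho> s)"

definition l1_norm :: "real ^ 'k::finite \<Rightarrow> real" where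
  "l1_norm x = (\<Sum>i\<in>UNIV. \<bar>x $ i\<bar>)"

definition policy_of_mass ::
  "('s::finite \<times> 'a::finite) pmf \<Rightarrow> real ^ ('s \<times> 'a) \<Rightarrow> 's \<Rightarrow> 'a \<Rightarrow> real" where
  "policy_of_mass \<mu> w s a =
     (if (\<Sum>a'\<in>UNIV. w $ (s, a') * behavior \<mu> s a') > 0
      then w $ (s, a) * behavior \<mu> s a / (\<Sum>a'\<in>UNIV. w $ (s, a') * behavior \<mu> s a')
      else 1 / real CARD('a))"

text \<open>The policy \<open>\<pi>\<^sub>w\<close>. It is used only for \<open>w \<ge> 0\<close>, where it has the mass function
  \<open>policy_of_mass \<mu> w\<close> by \<open>pmf_policy_of\<close> below; otherwise \<open>embed_pmf\<close> may be unspecified.\<close>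

definition policy_of ::
  "('s::finite \<times> 'a::finite) pmf \<Rightarrow> real ^ ('s \<times> 'a) \<Rightarrow> 's \<Rightarrow> 'a pmf" where
  "policy_of \<mu> w s = embed_pmf (policy_of_mass \<mu> w s)"

lemma pmf_policy_of:
  assumes "\<And>sa. 0 \<le> w $ sa"
  shows "pmf (policy_of \<mu> w s) a = policy_of_mass \<mu> w s a"
proof -
  have beh: "0 \<le> behavior \<mu> s b" for b
    by (simp add: behavior_def)
  have nonneg: "0 \<le> policy_of_mass \<mu> w s b" for b
    using assms beh by (simp add: policy_of_mass_def)
  have "(\<Sum>b\<in>UNIV. policy_of_mass \<mu> w s b) = 1"
    by (cases "(\<Sum>a'\<in>UNIV. w $ (s, a') * behavior \<mu> s a') > 0")
      (simp_all add: policy_of_mass_def flip: sum_divide_distrib)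
  then have "(\<integral>\<^sup>+ b. ennreal (policy_of_mass \<mu> w s b) \<partial>count_space UNIV) = 1"
    using nonneg by (simp add: nn_integral_count_space_finite sum_ennreal)
  then show ?thesis
    unfolding policy_of_def using nonneg by (intro pmf_embed_pmf) auto
qed

definition W_set :: "real \<Rightarrow> (real ^ ('s::finite \<times> 'a::finite)) set" where
  "W_set B = {w. (\<forall>sa. 0 \<le> w $ sa) \<and> (\<forall>s. (\<Sum>a\<in>UNIV. w $ (s, a)) \<le> B)}"

definition population_solution ::
  "('s::finite \<times> 'a::finite \<Rightarrow> 's pmf) \<Rightarrow> ('s \<times> 'a \<Rightarrow> real) \<Rightarrow> real \<Rightarrow> 's pmf \<Rightarrow> ('s \<times> 'a) pmf
     \<Rightarrow> real ^ ('s \<times> 'a) \<Rightarrow> bool" where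
  "population_solution P r \<gamma> \<mu>\<^sub>0 \<mu> =
     is_arg_max (\<lambda>w. reward_vec r \<mu> \<bullet> w)
       (\<lambda>w. (\<forall>sa. 0 \<le> w $ sa) \<and> K_op P \<gamma> \<mu> w = (1 - \<gamma>) *\<^sub>R pmf_vec \<mu>\<^sub>0)"

definition empirical_solution ::
  "real \<Rightarrow> 's::finite pmf \<Rightarrow> real \<Rightarrow> real \<Rightarrow> nat \<Rightarrow> ('s, 'a::finite) dataset
     \<Rightarrow> real ^ ('s \<times> 'a) \<Rightarrow> bool" where
  "empirical_solution \<gamma> \<mu>\<^sub>0 B \<delta> n D =
     is_arg_max (emp_reward n D)
       (\<lambda>w. w \<in> W_set B \<and>
          l1_norm (emp_K \<gamma> n D w - (1 - \<gamma>) *\<^sub>R pmf_vec \<mu>\<^sub>0)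
            \<le> 2 * B * sqrt (real CARD('s) * ln ((2 * real CARD('a) + 2) / \<delta>)) / sqrt (real n))"

end

theory Submission
  imports Defs
begin

text \<open>Every \<open>w \<ge> 0\<close> satisfies \<open>u\<^sup>T w = V\<^sup>T K w\<close> for the value function \<open>V\<close> of \<open>\<pi>\<^sub>w\<close>, and
  \<open>J \<pi>\<^sub>w = (1 - \<gamma>) V\<^sup>T \<mu>\<^sub>0\<close>. Hence the suboptimality of \<open>w\<^sub>D\<close> is at most the sum of the deviation of
  \<open>u\<^sub>D\<^sup>T w\<^sub>o\<^sub>p\<^sub>t\<close>, the deviation of the Lagrangian \<open>u\<^sub>D\<^sup>T w - V\<^sup>T K\<^sub>D w\<close> at \<open>(w\<^sub>D, V)\<close>, and the constraint
  slack times \<open>1 / (1 - \<gamma>)\<close>. The Lagrangian is affine in each argument, so its deviation over \<open>W\<close> and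
  the cube of value functions is attained at one of \<open>(|A| + 1)\<^bsup>|S|\<^esup> \<cdot> 2\<^bsup>|S|\<^esup>\<close> pairs of vertices.
  Treating reward and constraint together roughly halves the range of the summands compared with
  separate bounds, which is what makes Hoeffding's inequality give the constant 4: with
  \<open>q = B (|S| log ((2|A| + 2) / \<delta>) / n)\<^bsup>1/2\<^esup>\<close> the three terms are at most \<open>q / 2\<close>,
  \<open>3 q / (2 (1 - \<gamma>))\<close> and \<open>2 q / (1 - \<gamma>)\<close>.\<close>

subsection \<open>Policy evaluation\<close>

text \<open>Point masses are at most 1, so each discounted series is dominated by a geometric one
  and the finite sum over state-action pairs moves inside the series.\<close>

lemma J_eq_suminf:
  fixes P :: "'s::finite \<times> 'a::finite \<Rightarrow> 's pmf"
  assumes "0 \<le> \<gamma>" "\<gamma> < 1"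
  shows "summable (\<lambda>t. \<gamma> ^ t * (\<Sum>sa\<in>UNIV. r sa * pmf (step_pmf P \<pi> \<rho> t) sa))"
    and "J P r \<gamma> \<rho> \<pi> = (1 - \<gamma>) * (\<Sum>t. \<gamma> ^ t * (\<Sum>sa\<in>UNIV. r sa * pmf (step_pmf P \<pi> \<rho> t) sa))"
proof -
  have sm: "summable (\<lambda>t. \<gamma> ^ t * pmf (step_pmf P \<pi> \<rho> t) sa)" for sa
  proof (rule summable_comparison_test'[where N = 0])
    show "summable (\<lambda>t. \<gamma> ^ t)"
      using assms by (intro summable_geometric) auto
    show "norm (\<gamma> ^ t * pmf (step_pmf P \<pi> \<rho> t) sa) \<le> \<gamma> ^ t" for t
      using assms by (simp add: abs_mult mult_left_le pmf_le_1)
  qed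
  have eq: "\<gamma> ^ t * (\<Sum>sa\<in>UNIV. r sa * pmf (step_pmf P \<pi> \<rho> t) sa) =
      (\<Sum>sa\<in>UNIV. r sa * (\<gamma> ^ t * pmf (step_pmf P \<pi> \<rho> t) sa))" for t
    by (simp add: sum_distrib_left mult_ac)
  show "summable (\<lambda>t. \<gamma> ^ t * (\<Sum>sa\<in>UNIV. r sa * pmf (step_pmf P \<pi> \<rho> t) sa))"
    unfolding eq by (intro summable_sum summable_mult sm)
  show "J P r \<gamma> \<rho> \<pi> = (1 - \<gamma>) * (\<Sum>t. \<gamma> ^ t * (\<Sum>sa\<in>UNIV. r sa * pmf (step_pmf P \<pi> \<rho> t) sa))"
    unfolding eq J_def occupancy_def
    by (subst suminf_sum, intro summable_mult sm)
       (simp add: suminf_mult[OF sm] sum_distrib_left mult_ac)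
qed

lemma J_bounds:
  fixes P :: "'s::finite \<times> 'a::finite \<Rightarrow> 's pmf"
  assumes "0 \<le> \<gamma>" "\<gamma> < 1" and r: "\<And>sa. 0 \<le> r sa \<and> r sa \<le> 1"
  shows "0 \<le> J P r \<gamma> \<rho> \<pi>" "J P r \<gamma> \<rho> \<pi> \<le> 1"
proof -
  define E where "E t = (\<Sum>sa\<in>UNIV. r sa * pmf (step_pmf P \<pi> \<rho> t) sa)" for t
  have E0: "0 \<le> E t" for t
    unfolding E_def using r by (intro sum_nonneg) auto
  have "E t \<le> (\<Sum>sa\<in>UNIV. pmf (step_pmf P \<pi> \<rho> t) sa)" for t
    unfolding E_def using r by (intro sum_mono) (auto intro: mult_left_le_one_le)
  then have E1: "E t \<le> 1" for t
    by (simp add: sum_pmf_eq_1)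
  note J = J_eq_suminf[OF assms(1,2), where P = P and r = r and \<pi> = \<pi> and \<rho> = \<rho>, folded E_def]
  show "0 \<le> J P r \<gamma> \<rho> \<pi>"
    unfolding J(2) using assms E0 J(1) by (intro mult_nonneg_nonneg suminf_nonneg) auto
  have "(\<Sum>t. \<gamma> ^ t * E t) \<le> (\<Sum>t. \<gamma> ^ t)"
    using assms E1 by (intro suminf_le J(1) summable_geometric) (auto intro: mult_left_le)
  also have "\<dots> = 1 / (1 - \<gamma>)"
    using assms by (intro suminf_geometric) auto
  finally show "J P r \<gamma> \<rho> \<pi> \<le> 1"
    unfolding J(2) using assms by (simp add: field_simps)
qed

lemma pmf_step_pmf_mixture:
  fixes P :: "'s::finite \<times> 'a::finite \<Rightarrow> 's pmf"
  shows "pmf (step_pmf P \<pi> \<rho> t) sa = (\<Sum>s\<in>UNIV. pmf \<rho> s * pmf (step_pmf P \<pi> (return_pmf s) t) sa)"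
proof -
  have "step_pmf P \<pi> \<rho> t = bind_pmf \<rho> (\<lambda>s. step_pmf P \<pi> (return_pmf s) t)"
    by (induction t) (simp_all add: bind_return_pmf bind_assoc_pmf)
  then show ?thesis
    by (simp add: pmf_bind integral_measure_pmf[of UNIV])
qed

text \<open>The law of the chain is linear in its initial distribution; this is what turns
  \<open>J\<close> into an inner product with a value vector.\<close>

lemma J_mixture:
  fixes P :: "'s::finite \<times> 'a::finite \<Rightarrow> 's pmf"
  shows "0 \<le> \<gamma> \<Longrightarrow> \<gamma> < 1 \<Longrightarrow> J P r \<gamma> \<rho> \<pi> = (\<Sum>s\<in>UNIV. pmf \<rho> s * J P r \<gamma> (return_pmf s) \<pi>)"
proof -
  assume \<gamma>: "0 \<le> \<gamma>" "\<gamma> < 1"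
  define E where "E \<rho> t = (\<Sum>sa\<in>UNIV. r sa * pmf (step_pmf P \<pi> \<rho> t) sa)" for \<rho> t
  have "E \<rho> t = (\<Sum>s\<in>UNIV. pmf \<rho> s * E (return_pmf s) t)" for t
    unfolding E_def pmf_step_pmf_mixture[of P \<pi> \<rho> t] sum_distrib_left
    by (subst sum.swap) (simp add: mult_ac)
  then have eq: "\<gamma> ^ t * E \<rho> t = (\<Sum>s\<in>UNIV. pmf \<rho> s * (\<gamma> ^ t * E (return_pmf s) t))" for t
    by (simp add: sum_distrib_left mult_ac)
  note J = J_eq_suminf[OF \<gamma>, where P = P and r = r and \<pi> = \<pi>, folded E_def]
  have "(\<Sum>t. \<gamma> ^ t * E \<rho> t) = (\<Sum>s\<in>UNIV. pmf \<rho> s * (\<Sum>t. \<gamma> ^ t * E (return_pmf s) t))"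
    unfolding eq by (subst suminf_sum, intro summable_mult J(1)) (simp only: suminf_mult[OF J(1)])
  then show ?thesis
    unfolding J(2) by (simp add: sum_distrib_left mult_ac)
qed

text \<open>The usual value function: dividing by \<open>1 - \<gamma>\<close> undoes the
  normalization in \<open>occupancy\<close>, so Bellman's equation carries the bare reward.\<close>

definition policy_value ::
  "('s::finite \<times> 'a::finite \<Rightarrow> 's pmf) \<Rightarrow> ('s \<times> 'a \<Rightarrow> real) \<Rightarrow> real \<Rightarrow> ('s \<Rightarrow> 'a pmf) \<Rightarrow> real ^ 's" where
  "policy_value P r \<gamma> \<pi> = (\<chi> s. J P r \<gamma> (return_pmf s) \<pi> / (1 - \<gamma>))"

lemma J_eq_policy_value:
  assumes "0 \<le> \<gamma>" "\<gamma> < 1"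
  shows "J P r \<gamma> \<rho> \<pi> = policy_value P r \<gamma> \<pi> \<bullet> ((1 - \<gamma>) *\<^sub>R pmf_vec \<rho>)"
  using assms by (subst J_mixture) (simp_all add: policy_value_def inner_vec_def pmf_vec_def mult_ac)

lemma policy_value_bounds:
  assumes "0 \<le> \<gamma>" "\<gamma> < 1" "\<And>sa. 0 \<le> r sa \<and> r sa \<le> 1"
  shows "0 \<le> policy_value P r \<gamma> \<pi> $ s" "policy_value P r \<gamma> \<pi> $ s \<le> 1 / (1 - \<gamma>)"
  using assms J_bounds[OF assms(1,2), of r] by (simp_all add: policy_value_def divide_right_mono)

text \<open>The recursion of \<open>step_pmf\<close> appends a step at the end, whereas Bellman's
  equation needs the first step peeled off.\<close>

lemma step_pmf_Suc_return:
  "step_pmf P \<pi> (return_pmf s) (Suc t) = bind_pmf (\<pi> s) (\<lambda>a. step_pmf P \<pi> (P (s, a)) t)"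
  by (induction t) (simp_all add: bind_return_pmf bind_map_pmf bind_assoc_pmf)

text \<open>Split off time 0 of the series. By \<open>step_pmf_Suc_return\<close> the rest is
  \<open>\<gamma>\<close> times the series restarted from \<open>P (s, a)\<close>, and
  \<open>J_mixture\<close> resolves that start into single states.\<close>

lemma bellman:
  fixes P :: "'s::finite \<times> 'a::finite \<Rightarrow> 's pmf" and r :: "'s \<times> 'a \<Rightarrow> real" and \<pi> :: "'s \<Rightarrow> 'a pmf"
  assumes \<gamma>: "0 \<le> \<gamma>" "\<gamma> < 1"
  defines "V \<equiv> policy_value P r \<gamma> \<pi>"
  shows "V $ s = (\<Sum>a\<in>UNIV. pmf (\<pi> s) a * (r (s, a) + \<gamma> * (\<Sum>s'\<in>UNIV. pmf (P (s, a)) s' * V $ s')))"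
proof -
  define E where "E \<rho> t = (\<Sum>sa\<in>UNIV. r sa * pmf (step_pmf P \<pi> \<rho> t) sa)" for \<rho> t
  note J = J_eq_suminf[OF \<gamma>, where P = P and r = r and \<pi> = \<pi>, folded E_def]
  have E0: "E (return_pmf s) 0 = (\<Sum>a\<in>UNIV. pmf (\<pi> s) a * r (s, a))"
  proof -
    have step0: "pmf (step_pmf P \<pi> (return_pmf s) 0) (s', a) = (if s' = s then pmf (\<pi> s) a else 0)" for s' a
    proof (cases "s' = s")
      case True
      then show ?thesis
        by (simp add: bind_return_pmf pmf_map_inj' inj_on_def)
    next
      case False
      then have "(s', a) \<notin> set_pmf (map_pmf (Pair s) (\<pi> s))"
        by auto
      with False show ?thesis
        by (simp add: bind_return_pmf pmf_eq_0_set_pmf)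
    qed
    show ?thesis
      unfolding E_def UNIV_Times_UNIV[symmetric] sum.cartesian_product' step0
      by (subst sum.swap) (simp add: if_distrib mult.commute cong: if_cong)
  qed
  have ES: "E (return_pmf s) (Suc t) = (\<Sum>a\<in>UNIV. pmf (\<pi> s) a * E (P (s, a)) t)" for t
  proof -
    have stepS: "pmf (step_pmf P \<pi> (return_pmf s) (Suc t)) sa =
        (\<Sum>a\<in>UNIV. pmf (\<pi> s) a * pmf (step_pmf P \<pi> (P (s, a)) t) sa)" for sa
      unfolding step_pmf_Suc_return by (simp add: pmf_bind integral_measure_pmf[of UNIV])
    show ?thesis
      unfolding E_def stepS sum_distrib_left by (subst sum.swap) (simp add: mult_ac)
  qed
  have Jd: "(\<Sum>t. \<gamma> ^ t * E \<rho> t) = J P r \<gamma> \<rho> \<pi> / (1 - \<gamma>)" for \<rho>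
    using \<gamma> by (simp add: J(2))
  have "V $ s = (\<Sum>t. \<gamma> ^ t * E (return_pmf s) t)"
    by (simp add: V_def policy_value_def Jd)
  also have "\<dots> = E (return_pmf s) 0 + (\<Sum>t. \<gamma> ^ Suc t * E (return_pmf s) (Suc t))"
    using suminf_split_head[OF J(1)[of "return_pmf s"]] by simp
  also have "(\<lambda>t. \<gamma> ^ Suc t * E (return_pmf s) (Suc t)) =
      (\<lambda>t. \<Sum>a\<in>UNIV. pmf (\<pi> s) a * \<gamma> * (\<gamma> ^ t * E (P (s, a)) t))"
    unfolding ES by (simp add: sum_distrib_left mult_ac)
  also have "suminf \<dots> = (\<Sum>a\<in>UNIV. pmf (\<pi> s) a * \<gamma> * (J P r \<gamma> (P (s, a)) \<pi> / (1 - \<gamma>)))"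
    by (subst suminf_sum, intro summable_mult J(1)) (simp only: suminf_mult[OF J(1)] Jd)
  finally show ?thesis
    unfolding E0
    by (simp add: J_mixture[OF \<gamma>, where \<rho> = "P (s, _)"] V_def policy_value_def
        sum.distrib algebra_simps sum_divide_distrib)
qed

text \<open>The measure with density \<open>w\<close> relative to \<open>\<mu>\<close> has
  \<open>policy_of \<mu> w\<close> as its conditional law of actions. Averaging Bellman's equation
  over it gives reward plus discounted inflow of value, and \<open>K_op\<close> subtracts exactly
  that inflow.\<close>

lemma bellman_flow:
  assumes \<gamma>: "0 \<le> \<gamma>" "\<gamma> < 1" and w: "\<And>sa. 0 \<le> w $ sa"
  shows "policy_value P r \<gamma> (policy_of \<mu> w) \<bullet> K_op P \<gamma> \<mu> w = reward_vec r \<mu> \<bullet> w"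
proof -
  define \<pi> where "\<pi> = policy_of \<mu> w"
  define V where "V = policy_value P r \<gamma> \<pi>"
  define \<theta> where "\<theta> s a = w $ (s, a) * pmf \<mu> (s, a)" for s a
  have \<theta>0: "0 \<le> \<theta> s a" for s a
    using w by (simp add: \<theta>_def)
  \<comment> \<open>At states of marginal 0 \<open>behavior\<close> is 0, but \<open>\<mu>\<close>
    has no mass there either, so the factorization holds everywhere.\<close>
  have beh: "pmf \<mu> (s, a) = state_marginal \<mu> s * behavior \<mu> s a" for s a
  proof (cases "state_marginal \<mu> s > 0")
    case False
    moreover have "0 \<le> state_marginal \<mu> s"
      by (simp add: state_marginal_def sum_nonneg)
    ultimately have 0: "state_marginal \<mu> s = 0"
      by linarith
    then have "pmf \<mu> (s, a) = 0"
      unfolding state_marginal_def by (subst (asm) sum_nonneg_eq_0_iff) auto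
    with 0 show ?thesis
      by simp
  qed (simp add: behavior_def)
  \<comment> \<open>The uniform default of \<open>policy_of_mass\<close> applies only where
    \<open>\<theta>\<close> has no mass at \<open>s\<close>; both sides then vanish.\<close>
  have \<theta>\<pi>: "\<theta> s a = (\<Sum>a'\<in>UNIV. \<theta> s a') * pmf (\<pi> s) a" for s a
  proof -
    let ?d = "\<Sum>a'\<in>UNIV. w $ (s, a') * behavior \<mu> s a'"
    have sum\<theta>: "(\<Sum>a'\<in>UNIV. \<theta> s a') = state_marginal \<mu> s * ?d"
      by (simp add: \<theta>_def beh sum_distrib_left mult_ac)
    show ?thesis
    proof (cases "?d > 0")
      case True
      then show ?thesis
        by (simp add: \<pi>_def pmf_policy_of[OF w] policy_of_mass_def sum\<theta>) (simp add: \<theta>_def beh)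
    next
      case False
      moreover have "0 \<le> ?d"
        using w by (intro sum_nonneg) (auto simp: behavior_def)
      ultimately have "?d = 0"
        by linarith
      then have 0: "(\<Sum>a'\<in>UNIV. \<theta> s a') = 0"
        by (simp add: sum\<theta>)
      then have "\<theta> s a = 0"
        by (subst (asm) sum_nonneg_eq_0_iff) (auto simp: \<theta>0)
      with 0 show ?thesis
        by simp
    qed
  qed
  let ?Q = "\<lambda>s a. r (s, a) + \<gamma> * (\<Sum>s'\<in>UNIV. pmf (P (s, a)) s' * V $ s')"
  have Vs: "V $ s * (\<Sum>a\<in>UNIV. \<theta> s a) = (\<Sum>a\<in>UNIV. \<theta> s a * ?Q s a)" for s
  proof -
    have "(\<Sum>a\<in>UNIV. \<theta> s a * ?Q s a) = (\<Sum>a'\<in>UNIV. \<theta> s a') * (\<Sum>a\<in>UNIV. pmf (\<pi> s) a * ?Q s a)"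
      unfolding sum_distrib_left by (subst \<theta>\<pi>) (simp only: mult.assoc)
    then show ?thesis
      unfolding V_def bellman[OF \<gamma>, symmetric] by (simp only: mult.commute)
  qed
  \<comment> \<open>Exchanging the sums transposes the transition matrix: inflow paired with
    \<open>V\<close> becomes the expected next value under \<open>\<theta>\<close>.\<close>
  have flow: "(\<Sum>s\<in>UNIV. V $ s * (\<Sum>(s', a)\<in>UNIV. pmf (P (s', a)) s * w $ (s', a) * pmf \<mu> (s', a))) =
      (\<Sum>s\<in>UNIV. \<Sum>a\<in>UNIV. \<theta> s a * (\<Sum>s'\<in>UNIV. pmf (P (s, a)) s' * V $ s'))"
    unfolding sum_distrib_left
    by (subst sum.swap, subst UNIV_Times_UNIV[symmetric], subst sum.cartesian_product')
       (simp add: \<theta>_def mult_ac)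
  have "V \<bullet> K_op P \<gamma> \<mu> w = (\<Sum>s\<in>UNIV. V $ s * (\<Sum>a\<in>UNIV. \<theta> s a))
      - \<gamma> * (\<Sum>s\<in>UNIV. V $ s * (\<Sum>(s', a)\<in>UNIV. pmf (P (s', a)) s * w $ (s', a) * pmf \<mu> (s', a)))"
    by (simp add: inner_vec_def K_op_def \<theta>_def right_diff_distrib sum_subtractf mult_ac
        flip: sum_distrib_left)
  also have "\<dots> = (\<Sum>s\<in>UNIV. \<Sum>a\<in>UNIV. \<theta> s a * r (s, a))"
    unfolding flow Vs by (simp add: distrib_left sum.distrib sum_distrib_left mult_ac)
  also have "\<dots> = reward_vec r \<mu> \<bullet> w"
    unfolding inner_vec_def reward_vec_def UNIV_Times_UNIV[symmetric] sum.cartesian_product'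
    by (simp add: \<theta>_def mult_ac)
  finally show ?thesis
    unfolding V_def \<pi>_def .
qed

subsection \<open>Concentration of the empirical Lagrangian\<close>

text \<open>The coordinates of \<open>Pi_pmf\<close> are independent with common law
  \<open>p\<close>, which is the setting of the i.i.d. Hoeffding locale.\<close>

lemma hoeffding_Pi_pmf:
  fixes f :: "'b \<Rightarrow> real"
  assumes "\<And>x. x \<in> set_pmf p \<Longrightarrow> f x \<in> {a..b}" and "a < b" "0 < n" "0 \<le> \<epsilon>"
  shows "measure_pmf.prob (Pi_pmf {..<n} d (\<lambda>_. p))
      {D. (\<Sum>i<n. f (D i)) / real n \<ge> measure_pmf.expectation p f + \<epsilon>}
    \<le> exp (- 2 * real n * \<epsilon>\<^sup>2 / (b - a)\<^sup>2)"
proof -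
  let ?M = "Pi_pmf {..<n} d (\<lambda>_. p)"
  have comp: "map_pmf (\<lambda>D. D i) ?M = p" if "i < n" for i
    using that by (simp add: Pi_pmf_component)
  have distr: "distr ?M borel (\<lambda>D. f (D i)) = distr p borel f" if "i < n" for i
  proof -
    have "distr ?M borel (\<lambda>D. f (D i)) = distr (map_pmf (\<lambda>D. D i) ?M) borel f"
      by (simp add: map_pmf_rep_eq distr_distr o_def)
    then show ?thesis
      by (simp only: comp[OF that])
  qed
  interpret Hoeffding_ineq_iid "measure_pmf ?M" "{..<n}" "\<lambda>i D. f (D i)" "\<lambda>D. f (D 0)" a b
    "measure_pmf.expectation p f"
  proof unfold_locales
    show "prob_space.indep_vars (measure_pmf ?M) (\<lambda>_. borel) (\<lambda>i D. f (D i)) {..<n}"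
      by (intro prob_space.indep_vars_compose2[OF _ indep_vars_Pi_pmf])
        (auto simp: measure_pmf.prob_space_axioms)
    show "distr ?M borel (\<lambda>D. f (D i)) = distr ?M borel (\<lambda>D. f (D 0))" if "i \<in> {..<n}" for i
      using that \<open>0 < n\<close> by (simp add: distr)
    show "AE D in measure_pmf ?M. f (D 0) \<in> {a..b}"
      using assms(1) \<open>0 < n\<close> by (simp add: AE_measure_pmf_iff set_Pi_pmf PiE_dflt_def)
    have "measure_pmf.expectation p f = measure_pmf.expectation (map_pmf (\<lambda>D. D 0) ?M) f"
      using comp[OF \<open>0 < n\<close>] by simp
    then show "measure_pmf.expectation p f \<equiv> measure_pmf.expectation ?M (\<lambda>D. f (D 0))"
      by simp
  qed auto
  show ?thesis
    using Hoeffding_ineq_ge'[of \<epsilon>] assms by auto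
qed

lemma prob_finite_union_le:
  fixes Q :: "'i::finite \<Rightarrow> 'b \<Rightarrow> bool"
  assumes "\<And>i. measure_pmf.prob p {D. Q i D} \<le> \<delta>"
  shows "measure_pmf.prob p {D. \<exists>i. Q i D} \<le> real CARD('i) * \<delta>"
proof -
  have "measure_pmf.prob p {D. \<exists>i. Q i D} = measure_pmf.prob p (\<Union>i. {D. Q i D})"
    by (rule arg_cong[where f = "measure_pmf.prob p"]) auto
  also have "\<dots> \<le> (\<Sum>i\<in>UNIV. measure_pmf.prob p {D. Q i D})"
    by (intro measure_pmf.finite_measure_subadditive_finite) auto
  also have "\<dots> \<le> real CARD('i) * \<delta>"
    using sum_bounded_above[of UNIV "\<lambda>i. measure_pmf.prob p {D. Q i D}" \<delta>] assms by simp
  finally show ?thesis .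
qed

text \<open>The per-sample contribution to the LP Lagrangian \<open>c \<cdot> u\<^sup>T w - V\<^sup>T K w\<close>. The weight \<open>c\<close> takes the
  values \<open>1\<close>, \<open>0\<close> and \<open>-1\<close>, which isolates the three deviations to be controlled.\<close>

definition residual ::
  "real \<Rightarrow> real \<Rightarrow> real ^ ('s::finite \<times> 'a::finite) \<Rightarrow> real ^ 's \<Rightarrow> 's \<times> 'a \<times> 's \<times> real \<Rightarrow> real" where
  "residual \<gamma> c w V = (\<lambda>(s, a, s', x). w $ (s, a) * (c * x - V $ s + \<gamma> * V $ s'))"

text \<open>Pairing \<open>V\<close> with the indicators in \<open>emp_K\<close> leaves
  \<open>V $ s - \<gamma> * V $ s'\<close>, so the empirical Lagrangian is an average of i.i.d.
  terms.\<close>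

lemma mean_residual:
  "(\<Sum>i<n. residual \<gamma> c w V (D i)) / real n = c * emp_reward n D w - V \<bullet> emp_K \<gamma> n D w"
proof -
  have *: "(case d of (s, a, s', x) \<Rightarrow> w $ (s, a) * (c * x - V $ s + \<gamma> * V $ s')) =
      c * (case d of (s, a, s', x) \<Rightarrow> x * w $ (s, a)) -
      (\<Sum>t\<in>UNIV. V $ t * (case d of (s, a, s', x) \<Rightarrow>
         w $ (s, a) * (of_bool (s = t) - \<gamma> * of_bool (s' = t))))" for d
  proof (cases d)
    case (fields s a s' x)
    have "(\<Sum>t\<in>UNIV. V $ t * (w $ (s, a) * (of_bool (s = t) - \<gamma> * of_bool (s' = t)))) =
        (\<Sum>t\<in>UNIV. (if s = t then w $ (s, a) * V $ t else 0)
           - (if s' = t then \<gamma> * w $ (s, a) * V $ t else 0))"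
      by (intro sum.cong) (auto simp: algebra_simps)
    also have "\<dots> = w $ (s, a) * V $ s - \<gamma> * w $ (s, a) * V $ s'"
      by (simp add: sum_subtractf)
    finally show ?thesis
      by (simp add: fields algebra_simps)
  qed
  have "(\<Sum>t\<in>UNIV. V $ t * (\<Sum>i<n. case D i of (s, a, s', x) \<Rightarrow>
         w $ (s, a) * (of_bool (s = t) - \<gamma> * of_bool (s' = t)))) =
     (\<Sum>i<n. \<Sum>t\<in>UNIV. V $ t * (case D i of (s, a, s', x) \<Rightarrow>
         w $ (s, a) * (of_bool (s = t) - \<gamma> * of_bool (s' = t))))"
    unfolding sum_distrib_left by (rule sum.swap)
  then show ?thesis
    unfolding residual_def * emp_reward_def emp_K_def inner_vec_def
    by (simp add: sum_subtractf diff_divide_distrib flip: sum_distrib_left sum_divide_distrib)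
qed

text \<open>Average over the next state first, then over \<open>\<mu>\<close>; exchanging sums moves
  the transition kernel from \<open>V\<close> onto \<open>w\<close>, as in
  \<open>bellman_flow\<close>.\<close>

lemma expectation_residual:
  "measure_pmf.expectation (sample_pmf P r \<mu>) (residual \<gamma> c w V) =
     c * (reward_vec r \<mu> \<bullet> w) - V \<bullet> K_op P \<gamma> \<mu> w"
proof -
  let ?PV = "\<lambda>s a. \<Sum>s'\<in>UNIV. pmf (P (s, a)) s' * V $ s'"
  have sample: "sample_pmf P r \<mu> =
      bind_pmf \<mu> (\<lambda>sa. map_pmf (\<lambda>s'. (fst sa, snd sa, s', r sa)) (P sa))"
    by (simp add: sample_pmf_def case_prod_unfold)
  have inner: "measure_pmf.expectation (P (s, a)) (\<lambda>s'. residual \<gamma> c w V (s, a, s', x)) =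
      w $ (s, a) * (c * x - V $ s + \<gamma> * ?PV s a)" for s a x
  proof -
    have "measure_pmf.expectation (P (s, a)) (\<lambda>s'. residual \<gamma> c w V (s, a, s', x)) =
        (\<Sum>s'\<in>UNIV. pmf (P (s, a)) s' * (w $ (s, a) * (c * x - V $ s + \<gamma> * V $ s')))"
      by (subst integral_measure_pmf[of UNIV]) (auto simp: residual_def)
    also have "\<dots> = (\<Sum>s'\<in>UNIV. pmf (P (s, a)) s') * (w $ (s, a) * (c * x - V $ s))
        + w $ (s, a) * \<gamma> * ?PV s a"
      by (simp add: sum_distrib_left sum_distrib_right distrib_left distrib_right sum.distrib mult_ac)
    finally show ?thesis
      by (simp add: sum_pmf_eq_1 algebra_simps)
  qed
  have "measure_pmf.expectation (sample_pmf P r \<mu>) (residual \<gamma> c w V) =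
      (\<Sum>sa\<in>UNIV. pmf \<mu> sa * measure_pmf.expectation (P sa)
         (\<lambda>s'. residual \<gamma> c w V (fst sa, snd sa, s', r sa)))"
    unfolding sample by (subst pmf_expectation_bind[of UNIV]) auto
  also have "\<dots> = (\<Sum>s\<in>UNIV. \<Sum>a\<in>UNIV. pmf \<mu> (s, a) *
      (w $ (s, a) * (c * r (s, a) - V $ s + \<gamma> * ?PV s a)))"
    by (simp add: inner sum.cartesian_product' flip: UNIV_Times_UNIV)
  also have "\<dots> = c * (\<Sum>s\<in>UNIV. \<Sum>a\<in>UNIV. r (s, a) * pmf \<mu> (s, a) * w $ (s, a))
      - (\<Sum>s\<in>UNIV. V $ s * (\<Sum>a\<in>UNIV. w $ (s, a) * pmf \<mu> (s, a)))
      + \<gamma> * (\<Sum>s\<in>UNIV. \<Sum>a\<in>UNIV. pmf \<mu> (s, a) * w $ (s, a) * ?PV s a)"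
    by (simp add: sum_distrib_left sum.distrib sum_subtractf algebra_simps)
  also have "(\<Sum>s\<in>UNIV. \<Sum>a\<in>UNIV. pmf \<mu> (s, a) * w $ (s, a) * ?PV s a) =
      (\<Sum>t\<in>UNIV. V $ t * (\<Sum>(s', a)\<in>UNIV. pmf (P (s', a)) t * w $ (s', a) * pmf \<mu> (s', a)))"
    unfolding sum_distrib_left
    by (subst (2) sum.swap, subst UNIV_Times_UNIV[symmetric], subst sum.cartesian_product')
       (simp add: mult_ac)
  finally show ?thesis
    by (simp add: inner_vec_def K_op_def reward_vec_def right_diff_distrib sum_subtractf mult_ac
        sum.cartesian_product' flip: sum_distrib_left UNIV_Times_UNIV)
qed

text \<open>The range is tested only at reward \<open>r (s, a)\<close>, since samples carry no other
  reward.\<close>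

lemma residual_deviation:
  assumes "\<And>s a s'. residual \<gamma> c w V (s, a, s', r (s, a)) \<in> {lo..hi}"
    and "lo < hi" "0 < n" "0 \<le> \<epsilon>"
  shows "measure_pmf.prob (dataset_pmf P r \<mu> n)
      {D. c * emp_reward n D w - V \<bullet> emp_K \<gamma> n D w
          \<ge> c * (reward_vec r \<mu> \<bullet> w) - V \<bullet> K_op P \<gamma> \<mu> w + \<epsilon>}
    \<le> exp (- 2 * real n * \<epsilon>\<^sup>2 / (hi - lo)\<^sup>2)"
  unfolding dataset_pmf_def mean_residual[symmetric] expectation_residual[symmetric]
  by (rule hoeffding_Pi_pmf) (use assms in \<open>auto simp: sample_pmf_def\<close>)

section \<open>Linearity and reduction to vertices\<close>

lemma linear_emp_reward: "linear (emp_reward n D)"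
proof (rule linearI)
  show "emp_reward n D (v + w) = emp_reward n D v + emp_reward n D w" for v w
    by (simp add: emp_reward_def case_prod_unfold distrib_left sum.distrib add_divide_distrib)
  show "emp_reward n D (c *\<^sub>R w) = c *\<^sub>R emp_reward n D w" for c w
    by (simp add: emp_reward_def case_prod_unfold sum_distrib_left mult_ac)
qed

lemma linear_emp_K: "linear (emp_K \<gamma> n D)"
proof (rule linearI)
  show "emp_K \<gamma> n D (v + w) = emp_K \<gamma> n D v + emp_K \<gamma> n D w" for v w
    by (simp add: emp_K_def vec_eq_iff case_prod_unfold distrib_right sum.distrib add_divide_distrib)
  show "emp_K \<gamma> n D (c *\<^sub>R w) = c *\<^sub>R emp_K \<gamma> n D w" for c w
    by (simp add: emp_K_def vec_eq_iff case_prod_unfold sum_distrib_left mult_ac)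
qed

lemma linear_K_op: "linear (K_op P \<gamma> \<mu>)"
proof (rule linearI)
  show "K_op P \<gamma> \<mu> (v + w) = K_op P \<gamma> \<mu> v + K_op P \<gamma> \<mu> w" for v w
    by (simp add: K_op_def vec_eq_iff case_prod_unfold algebra_simps sum.distrib)
  show "K_op P \<gamma> \<mu> (c *\<^sub>R w) = c *\<^sub>R K_op P \<gamma> \<mu> w" for c w
    by (simp add: K_op_def vec_eq_iff case_prod_unfold right_diff_distrib sum_distrib_left mult_ac)
qed

text \<open>For \<open>B > 0\<close>, the vertices of \<open>W_set B\<close>: a product over states
  of truncated simplices, each with vertices the origin (\<open>None\<close>) and \<open>B\<close>
  times a unit vector (\<open>Some a\<close>).\<close>

definition vertex_weight :: "real \<Rightarrow> ('s \<Rightarrow> 'a option) \<Rightarrow> real ^ ('s::finite \<times> 'a::finite)" where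
  "vertex_weight B \<sigma> = (\<chi> sa. if \<sigma> (fst sa) = Some (snd sa) then B else 0)"

text \<open>The vertices of the cube of vectors with entries in [0, c].\<close>

definition vertex_value :: "real \<Rightarrow> 's set \<Rightarrow> real ^ 's::finite" where
  "vertex_value c T = (\<chi> s. if s \<in> T then c else 0)"

text \<open>The vertices of the unit ball dual to the l1 norm.\<close>

definition sign_vec :: "'s set \<Rightarrow> real ^ 's::finite" where
  "sign_vec T = (\<chi> s. if s \<in> T then 1 else -1)"

lemma linear_eq_sum:
  fixes f :: "real ^ 'k::finite \<Rightarrow> real"
  assumes "linear f"
  shows "f x = (\<Sum>i\<in>UNIV. x $ i * f (axis i 1))"
proof -
  have "f x = f (\<Sum>i\<in>UNIV. x $ i *\<^sub>R axis i 1)"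
    by (simp add: basis_expansion flip: scalar_mult_eq_scaleR)
  also have "\<dots> = (\<Sum>i\<in>UNIV. x $ i * f (axis i 1))"
    using assms by (simp add: linear_sum linear_scale)
  finally show ?thesis .
qed

text \<open>The constraints decouple over states. At each state a linear objective is maximal with
  the whole budget on the best action, or with nothing if even the best coefficient is
  negative.\<close>

lemma linear_le_vertex_weight:
  fixes f :: "real ^ ('s::finite \<times> 'a::finite) \<Rightarrow> real"
  assumes f: "linear f" and w: "w \<in> W_set B"
  obtains \<sigma> where "f w \<le> f (vertex_weight B \<sigma>)"
proof -
  define g where "g s a = f (axis (s, a) 1)" for s a
  have f_eq: "f x = (\<Sum>s\<in>UNIV. \<Sum>a\<in>UNIV. x $ (s, a) * g s a)" for x
    unfolding linear_eq_sum[OF f, of x] UNIV_Times_UNIV[symmetric] sum.cartesian_product' g_def ..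
  have w0: "0 \<le> w $ sa" and wB: "(\<Sum>a\<in>UNIV. w $ (s, a)) \<le> B" for sa s
    using w unfolding W_set_def by blast+
  have "\<exists>ao. (\<Sum>a\<in>UNIV. w $ (s, a) * g s a) \<le> (\<Sum>a\<in>UNIV. (if ao = Some a then B else 0) * g s a)" for s
  proof -
    have "Max (range (g s)) \<in> range (g s)"
      by (intro Max_in) auto
    then obtain a where "g s a = Max (range (g s))"
      by force
    then have a: "g s b \<le> g s a" for b
      by simp
    have le: "(\<Sum>b\<in>UNIV. w $ (s, b) * g s b) \<le> (\<Sum>b\<in>UNIV. w $ (s, b)) * g s a"
      unfolding sum_distrib_right using a w0 by (intro sum_mono mult_left_mono) auto
    show ?thesis
    proof (cases "g s a \<ge> 0")
      case True
      then have "(\<Sum>b\<in>UNIV. w $ (s, b) * g s b) \<le> B * g s a"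
        using le wB[of s] by (meson mult_right_mono order_trans)
      moreover have "(\<Sum>b\<in>UNIV. (if Some a = Some b then B else 0) * g s b) = B * g s a"
        by (simp add: if_distrib[of "\<lambda>x. x * _"] cong: if_cong)
      ultimately show ?thesis
        by metis
    next
      case False
      then have "(\<Sum>b\<in>UNIV. w $ (s, b)) * g s a \<le> 0"
        using w0 by (intro mult_nonneg_nonpos sum_nonneg) auto
      with le show ?thesis
        by (intro exI[of _ None]) simp
    qed
  qed
  then obtain \<sigma> where "\<And>s. (\<Sum>a\<in>UNIV. w $ (s, a) * g s a)
      \<le> (\<Sum>a\<in>UNIV. (if \<sigma> s = Some a then B else 0) * g s a)"
    by metis
  then have "f w \<le> f (vertex_weight B \<sigma>)"
    unfolding f_eq vertex_weight_def vec_lambda_beta fst_conv snd_conv by (rule sum_mono)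
  then show thesis
    by (rule that)
qed

lemma linear_le_vertex_value:
  fixes f :: "real ^ 's::finite \<Rightarrow> real"
  assumes f: "linear f" and V: "\<And>s. 0 \<le> V $ s" "\<And>s. V $ s \<le> c"
  obtains T where "f V \<le> f (vertex_value c T)"
proof
  let ?T = "{s. f (axis s 1) > 0}"
  show "f V \<le> f (vertex_value c ?T)"
    unfolding linear_eq_sum[OF f, of V] linear_eq_sum[OF f, of "vertex_value c ?T"]
    using V by (intro sum_mono)
      (auto simp: vertex_value_def mult_right_mono mult_nonneg_nonpos not_less)
qed

lemma l1_norm_eq_sign_vec: "l1_norm x = sign_vec {s. x $ s > 0} \<bullet> x"
  unfolding l1_norm_def inner_vec_def by (intro sum.cong) (auto simp: sign_vec_def)

lemma inner_le_l1_norm: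
  assumes "\<And>s. \<bar>V $ s\<bar> \<le> c"
  shows "V \<bullet> x \<le> c * l1_norm x"
  unfolding l1_norm_def inner_vec_def sum_distrib_left
proof (intro sum_mono)
  fix s
  have "V $ s * x $ s \<le> \<bar>V $ s\<bar> * \<bar>x $ s\<bar>"
    by (simp flip: abs_mult)
  also have "\<dots> \<le> c * \<bar>x $ s\<bar>"
    using assms by (intro mult_right_mono) auto
  finally show "V $ s \<bullet> x $ s \<le> c * \<bar>x $ s\<bar>"
    by simp
qed

lemma W_set_bounds:
  assumes "w \<in> W_set B"
  shows "0 \<le> w $ sa" "w $ sa \<le> B"
proof -
  have w0: "0 \<le> w $ sa" and wB: "(\<Sum>a\<in>UNIV. w $ (s, a)) \<le> B" for sa s
    using assms unfolding W_set_def by blast+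
  show "0 \<le> w $ sa"
    by (rule w0)
  obtain s a where sa: "sa = (s, a)"
    by (cases sa)
  have "w $ (s, a) \<le> (\<Sum>a\<in>UNIV. w $ (s, a))"
    using w0 by (intro member_le_sum) auto
  with wB[of s] show "w $ sa \<le> B"
    unfolding sa by linarith
qed

lemma vertex_weight_bounds:
  "0 \<le> B \<Longrightarrow> 0 \<le> vertex_weight B \<sigma> $ sa" "0 \<le> B \<Longrightarrow> vertex_weight B \<sigma> $ sa \<le> B"
  by (simp_all add: vertex_weight_def)

section \<open>Attainment of the empirical optimum\<close>

lemma compact_W_set: "compact (W_set B :: (real ^ ('s::finite \<times> 'a::finite)) set)"
  unfolding compact_eq_bounded_closed
proof
  have "norm w \<le> real CARD('s \<times> 'a) * B" if "w \<in> W_set B" for w :: "real ^ ('s \<times> 'a)"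
  proof -
    have "norm w \<le> (\<Sum>i\<in>UNIV. \<bar>w $ i\<bar>)"
      by (rule norm_le_l1_cart)
    also have "\<dots> \<le> real CARD('s \<times> 'a) * B"
      using W_set_bounds[OF that] by (intro sum_bounded_above) auto
    finally show ?thesis .
  qed
  then show "bounded (W_set B :: (real ^ ('s \<times> 'a)) set)"
    unfolding bounded_iff by blast
  show "closed (W_set B :: (real ^ ('s \<times> 'a)) set)"
    unfolding W_set_def
    by (intro closed_Collect_conj closed_Collect_all closed_Collect_le continuous_intros)
qed

text \<open>The feasible set is compact, the objective is linear and hence continuous, and
  \<open>w\<close> witnesses nonemptiness, so the maximum is attained.\<close>

lemma ex_empirical_solution:
  fixes w :: "real ^ ('s::finite \<times> 'a::finite)"
  assumes "w \<in> W_set B"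
    and "l1_norm (emp_K \<gamma> n D w - (1 - \<gamma>) *\<^sub>R pmf_vec \<mu>\<^sub>0)
      \<le> 2 * B * sqrt (real CARD('s) * ln ((2 * real CARD('a) + 2) / \<delta>)) / sqrt (real n)"
      (is "_ \<le> ?\<epsilon>")
  shows "\<exists>w'. empirical_solution \<gamma> \<mu>\<^sub>0 B \<delta> n D w'"
proof -
  let ?F = "{w :: real ^ ('s \<times> 'a). l1_norm (emp_K \<gamma> n D w - (1 - \<gamma>) *\<^sub>R pmf_vec \<mu>\<^sub>0) \<le> ?\<epsilon>}"
  have cont: "continuous_on UNIV (emp_K \<gamma> n D)" "continuous_on UNIV (emp_reward n D)"
    by (simp_all add: linear_continuous_on linear_linear linear_emp_K linear_emp_reward)
  have "closed ?F"
    unfolding l1_norm_def by (intro closed_Collect_le continuous_intros cont(1))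
  then have "compact (W_set B \<inter> ?F)"
    by (intro compact_Int_closed compact_W_set)
  moreover have "W_set B \<inter> ?F \<noteq> {}"
    using assms by blast
  ultimately obtain w' where "w' \<in> W_set B \<inter> ?F"
    and "\<forall>v\<in>W_set B \<inter> ?F. emp_reward n D v \<le> emp_reward n D w'"
    using continuous_attains_sup[of _ "emp_reward n D"] continuous_on_subset[OF cont(2)] by blast
  then show ?thesis
    unfolding empirical_solution_def is_arg_max_linorder by blast
qed

section \<open>The three deviation bounds\<close>

lemma lagrangian_uniform_deviation:
  fixes P :: "'s::finite \<times> 'a::finite \<Rightarrow> 's pmf"
  assumes r: "\<And>sa. 0 \<le> r sa \<and> r sa \<le> 1" and \<gamma>: "0 \<le> \<gamma>" "\<gamma> < 1"
    and "0 < B" "0 < n" "0 \<le> \<epsilon>"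
  shows "measure_pmf.prob (dataset_pmf P r \<mu> n)
      {D. \<exists>w\<in>W_set B. \<exists>V. (\<forall>s. 0 \<le> V $ s \<and> V $ s \<le> 1 / (1 - \<gamma>)) \<and>
         reward_vec r \<mu> \<bullet> w - V \<bullet> K_op P \<gamma> \<mu> w + \<epsilon> \<le> emp_reward n D w - V \<bullet> emp_K \<gamma> n D w}
    \<le> (2 * real CARD('a) + 2) ^ CARD('s) * exp (- 2 * real n * \<epsilon>\<^sup>2 / (2 * (B / (1 - \<gamma>)))\<^sup>2)"
proof -
  define c where "c = 1 / (1 - \<gamma>)"
  \<comment> \<open>This identity keeps the summands in an interval of half-length
    \<open>B * c\<close>: the reward plus the discounted next value is at most
    \<open>1 + \<gamma> * c\<close>, hence at most \<open>c\<close>.\<close>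
  have c: "1 + \<gamma> * c = c" "0 < c"
    using \<gamma> by (simp_all add: c_def field_simps)
  define dev where "dev D w V = (emp_reward n D w - V \<bullet> emp_K \<gamma> n D w)
      - (reward_vec r \<mu> \<bullet> w - V \<bullet> K_op P \<gamma> \<mu> w)"
    for D and w :: "real ^ ('s \<times> 'a)" and V
  let ?Q = "\<lambda>(\<sigma>, T) D. \<epsilon> \<le> dev D (vertex_weight B \<sigma>) (vertex_value c T)"
  have "\<exists>i. ?Q i D" if w: "w \<in> W_set B" and V: "\<forall>s. 0 \<le> V $ s \<and> V $ s \<le> c" and dev: "\<epsilon> \<le> dev D w V"
    for D w V
  proof -
    have "linear (\<lambda>w. dev D w V)"
      unfolding dev_def
      by (intro linear_compose_sub linear_emp_reward
          linear_compose[of "emp_K \<gamma> n D" "(\<bullet>) V", unfolded o_def]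
          linear_compose[of "K_op P \<gamma> \<mu>" "(\<bullet>) V", unfolded o_def]
          linear_emp_K linear_K_op bounded_linear.linear[OF bounded_linear_inner_right])
    \<comment> \<open>The weight moves to a vertex with \<open>V\<close> fixed; only then does
      \<open>V\<close> move, with that vertex fixed.\<close>
    then obtain \<sigma> where \<sigma>: "dev D w V \<le> dev D (vertex_weight B \<sigma>) V"
      using linear_le_vertex_weight w by blast
    let ?w = "vertex_weight B \<sigma>"
    have "linear (\<lambda>V. V \<bullet> (K_op P \<gamma> \<mu> ?w - emp_K \<gamma> n D ?w))"
      by (intro bounded_linear.linear[OF bounded_linear_inner_left])
    then obtain T where "V \<bullet> (K_op P \<gamma> \<mu> ?w - emp_K \<gamma> n D ?w)
        \<le> vertex_value c T \<bullet> (K_op P \<gamma> \<mu> ?w - emp_K \<gamma> n D ?w)"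
      using linear_le_vertex_value[of "\<lambda>V. V \<bullet> (K_op P \<gamma> \<mu> ?w - emp_K \<gamma> n D ?w)" V c] V by blast
    then have "dev D ?w V \<le> dev D ?w (vertex_value c T)"
      by (simp add: dev_def inner_diff_right)
    with \<sigma> dev have "?Q (\<sigma>, T) D"
      by simp
    then show ?thesis ..
  qed
  then have "measure_pmf.prob (dataset_pmf P r \<mu> n)
      {D. \<exists>w\<in>W_set B. \<exists>V. (\<forall>s. 0 \<le> V $ s \<and> V $ s \<le> c) \<and> \<epsilon> \<le> dev D w V}
    \<le> measure_pmf.prob (dataset_pmf P r \<mu> n) {D. \<exists>i. ?Q i D}"
    by (intro measure_pmf.finite_measure_mono) (blast, simp)
  also have "\<dots> \<le> real CARD(('s \<Rightarrow> 'a option) \<times> 's set)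
      * exp (- 2 * real n * \<epsilon>\<^sup>2 / (B * c - - (B * c))\<^sup>2)"
  proof (rule prob_finite_union_le)
    fix i :: "('s \<Rightarrow> 'a option) \<times> 's set"
    obtain \<sigma> T where i: "i = (\<sigma>, T)"
      by (cases i)
    let ?w = "vertex_weight B \<sigma>" and ?V = "vertex_value c T"
    have "residual \<gamma> 1 ?w ?V (s, a, s', r (s, a)) \<in> {- (B * c)..B * c}" for s a s'
    proof -
      have V: "0 \<le> ?V $ s" "?V $ s \<le> c" for s
        using c by (simp_all add: vertex_value_def)
      have "0 \<le> \<gamma> * ?V $ s'" "\<gamma> * ?V $ s' \<le> \<gamma> * c"
        using \<gamma> V by (simp_all add: mult_left_mono)
      then have "\<bar>r (s, a) - ?V $ s + \<gamma> * ?V $ s'\<bar> \<le> c"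
        using V[of s] r[of "(s, a)"] c by linarith
      then have "\<bar>?w $ (s, a) * (r (s, a) - ?V $ s + \<gamma> * ?V $ s')\<bar> \<le> B * c"
        unfolding abs_mult using vertex_weight_bounds[of B \<sigma>] \<open>0 < B\<close> by (intro mult_mono) auto
      then show ?thesis
        by (auto simp: residual_def abs_le_iff)
    qed
    from residual_deviation[OF this, of n \<epsilon> P \<mu>]
    show "measure_pmf.prob (dataset_pmf P r \<mu> n) {D. ?Q i D}
        \<le> exp (- 2 * real n * \<epsilon>\<^sup>2 / (B * c - - (B * c))\<^sup>2)"
      using \<open>0 < B\<close> c \<open>0 < n\<close> \<open>0 \<le> \<epsilon>\<close> by (simp add: i dev_def algebra_simps)
  qed
  also have "real CARD(('s \<Rightarrow> 'a option) \<times> 's set) = (2 * real CARD('a) + 2) ^ CARD('s)"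
    by (simp add: card_fun algebra_simps flip: power_mult_distrib)
  finally show ?thesis
    by (simp add: dev_def c_def algebra_simps)
qed

text \<open>Here \<open>w\<close> is fixed in advance, so the union bound runs only over the sign
  patterns that realize the l1 norm.\<close>

lemma emp_K_deviation:
  fixes P :: "'s::finite \<times> 'a::finite \<Rightarrow> 's pmf"
  assumes "0 \<le> \<gamma>" "\<gamma> < 1" "0 < B" "0 < n" "0 \<le> \<epsilon>" and w: "w \<in> W_set B"
  shows "measure_pmf.prob (dataset_pmf P r \<mu> n) {D. \<epsilon> \<le> l1_norm (emp_K \<gamma> n D w - K_op P \<gamma> \<mu> w)}
    \<le> 2 ^ CARD('s) * exp (- 2 * real n * \<epsilon>\<^sup>2 / (4 * B)\<^sup>2)"
proof -
  let ?Q = "\<lambda>T D. \<epsilon> \<le> sign_vec T \<bullet> (emp_K \<gamma> n D w - K_op P \<gamma> \<mu> w)"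
  have "measure_pmf.prob (dataset_pmf P r \<mu> n) {D. \<epsilon> \<le> l1_norm (emp_K \<gamma> n D w - K_op P \<gamma> \<mu> w)}
      \<le> measure_pmf.prob (dataset_pmf P r \<mu> n) {D. \<exists>T. ?Q T D}"
    unfolding l1_norm_eq_sign_vec by (intro measure_pmf.finite_measure_mono) auto
  also have "\<dots> \<le> real CARD('s set) * exp (- 2 * real n * \<epsilon>\<^sup>2 / (2 * B - - (2 * B))\<^sup>2)"
  proof (rule prob_finite_union_le)
    fix T :: "'s set"
    \<comment> \<open>Weight 0 removes the reward, and the minus sign cancels the one in front of
      \<open>V\<close> in the Lagrangian.\<close>
    have "residual \<gamma> 0 w (- sign_vec T) (s, a, s', r (s, a)) \<in> {- (2 * B)..2 * B}" for s a s'
    proof -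
      have "\<bar>sign_vec T $ s - \<gamma> * sign_vec T $ s'\<bar> \<le> 2"
        using assms by (auto simp: sign_vec_def)
      then have "\<bar>w $ (s, a) * (sign_vec T $ s - \<gamma> * sign_vec T $ s')\<bar> \<le> B * 2"
        unfolding abs_mult using W_set_bounds[OF w] \<open>0 < B\<close> by (intro mult_mono) auto
      then show ?thesis
        by (auto simp: residual_def abs_le_iff)
    qed
    from residual_deviation[OF this, of n \<epsilon> P \<mu>]
    show "measure_pmf.prob (dataset_pmf P r \<mu> n) {D. ?Q T D}
        \<le> exp (- 2 * real n * \<epsilon>\<^sup>2 / (2 * B - - (2 * B))\<^sup>2)"
      using assms by (simp add: inner_diff_right algebra_simps)
  qed
  finally show ?thesis
    by simp
qed

lemma emp_reward_deviation:
  fixes P :: "'s::finite \<times> 'a::finite \<Rightarrow> 's pmf"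
  assumes r: "\<And>sa. 0 \<le> r sa \<and> r sa \<le> 1" and "0 < B" "0 < n" "0 \<le> \<epsilon>" and w: "w \<in> W_set B"
  shows "measure_pmf.prob (dataset_pmf P r \<mu> n) {D. emp_reward n D w + \<epsilon> \<le> reward_vec r \<mu> \<bullet> w}
    \<le> exp (- 2 * real n * \<epsilon>\<^sup>2 / B\<^sup>2)"
proof -
  \<comment> \<open>Weight -1 turns the upper tail into the lower one. With \<open>V = 0\<close> the
    discount has no effect, so 0 can stand for it.\<close>
  have "residual 0 (- 1) w 0 (s, a, s', r (s, a)) \<in> {- B..0}" for s a s'
    using mult_mono[of "w $ (s, a)" B "r (s, a)" 1] W_set_bounds[OF w, of "(s, a)"] r[of "(s, a)"]
      \<open>0 < B\<close> by (simp add: residual_def)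
  from residual_deviation[OF this, of n \<epsilon> P \<mu>] show ?thesis
    using assms by (simp add: algebra_simps)
qed



subsection \<open>Suboptimality of the empirical solution\<close>

theorem theorem2:
  fixes P :: "'s::finite \<times> 'a::finite \<Rightarrow> 's pmf"
    and r :: "'s \<times> 'a \<Rightarrow> real"
    and \<gamma> :: real
    and \<mu>\<^sub>0 :: "'s pmf"
    and \<mu> :: "('s \<times> 'a) pmf"
    and B\<^sub>W \<delta> C :: real
    and n :: nat
    and \<pi>_opt :: "'s \<Rightarrow> 'a pmf"
    and w_opt :: "real ^ ('s \<times> 'a)"
  assumes "\<And>sa. 0 \<le> r sa \<and> r sa \<le> 1"
    and "0 \<le> \<gamma>" "\<gamma> < 1"
    and "0 < B\<^sub>W" "0 < \<delta>" "\<delta> < 1"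
    and "0 < n"
    and "min CARD('a) CARD('s) > 1"
    and "is_arg_max (J P r \<gamma> \<mu>\<^sub>0) (\<lambda>_. True) \<pi>_opt"
    and "0 < C" "\<And>sa. occupancy P \<gamma> \<pi>_opt \<mu>\<^sub>0 sa \<le> C * pmf \<mu> sa"
    and "w_opt \<in> W_set B\<^sub>W"
    and "population_solution P r \<gamma> \<mu>\<^sub>0 \<mu> w_opt"
    and "policy_of \<mu> w_opt = \<pi>_opt"
  shows "measure_pmf.prob (dataset_pmf P r \<mu> n)
      {D. (\<exists>w. empirical_solution \<gamma> \<mu>\<^sub>0 B\<^sub>W \<delta> n D w) \<and>
          (\<forall>w. empirical_solution \<gamma> \<mu>\<^sub>0 B\<^sub>W \<delta> n D w \<longrightarrow>
             J P r \<gamma> \<mu>\<^sub>0 \<pi>_opt - J P r \<gamma> \<mu>\<^sub>0 (policy_of \<mu> w)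
               \<le> 4 * B\<^sub>W * sqrt (real CARD('s) * ln ((2 * real CARD('a) + 2) / \<delta>))
                   / ((1 - \<gamma>) * sqrt (real n)))}
      \<ge> 1 - 6 * \<delta>"
proof -
  let ?S = "real CARD('s)" and ?A = "real CARD('a)"
  define L where "L = ln ((2 * ?A + 2) / \<delta>)"
  \<comment> \<open>The common scale: the constraint tolerance is \<open>2 * q\<close> and the
    claimed bound is \<open>4 * q / (1 - \<gamma>)\<close>.\<close>
  define q where "q = B\<^sub>W * sqrt (?S * L) / sqrt (real n)"
  note \<gamma> = assms(2,3) and r = assms(1)
  have S2: "2 \<le> CARD('s)" and A2: "2 \<le> ?A"
    using \<open>min CARD('a) CARD('s) > 1\<close> by auto
  have L: "0 < L" and exp_L: "exp (- L) = \<delta> / (2 * ?A + 2)"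
    using assms(5,6) A2 by (auto simp: L_def exp_minus intro!: ln_gt_zero)
  have q0: "0 \<le> q" and q2: "real n * q\<^sup>2 = B\<^sub>W\<^sup>2 * (?S * L)"
    using \<open>0 < B\<^sub>W\<close> \<open>0 < n\<close> L by (simp_all add: q_def power_mult_distrib power_divide)

  \<comment> \<open>Failure events and their probabilities\<close>
  define bad1 where "bad1 = {D. \<exists>w\<in>W_set B\<^sub>W. \<exists>V. (\<forall>s. 0 \<le> V $ s \<and> V $ s \<le> 1 / (1 - \<gamma>)) \<and>
    reward_vec r \<mu> \<bullet> w - V \<bullet> K_op P \<gamma> \<mu> w + 3 / 2 * q / (1 - \<gamma>)
      \<le> emp_reward n D w - V \<bullet> emp_K \<gamma> n D w}"
  define bad2 where "bad2 = {D. 2 * q \<le> l1_norm (emp_K \<gamma> n D w_opt - K_op P \<gamma> \<mu> w_opt)}"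
  define bad3 where "bad3 = {D. emp_reward n D w_opt + q / 2 \<le> reward_vec r \<mu> \<bullet> w_opt}"
  let ?prob = "measure_pmf.prob (dataset_pmf P r \<mu> n)"

  have cancel: "- 2 * real n * (3 / 2 * q / d)\<^sup>2 / (2 * (B\<^sub>W / d))\<^sup>2 = - (9 / 8) * (real n * q\<^sup>2) / B\<^sub>W\<^sup>2"
    if "d \<noteq> 0" for d
    using that \<open>0 < B\<^sub>W\<close> by (simp add: power_divide power_mult_distrib divide_simps)
  have "?prob bad1 \<le> (2 * ?A + 2) ^ CARD('s) *
      exp (- 2 * real n * (3 / 2 * q / (1 - \<gamma>))\<^sup>2 / (2 * (B\<^sub>W / (1 - \<gamma>)))\<^sup>2)"
    unfolding bad1_def using assms q0 by (intro lagrangian_uniform_deviation) auto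
  also have "- 2 * real n * (3 / 2 * q / (1 - \<gamma>))\<^sup>2 / (2 * (B\<^sub>W / (1 - \<gamma>)))\<^sup>2 =
      - (9 / 8) * (real n * q\<^sup>2) / B\<^sub>W\<^sup>2"
    using \<gamma> by (intro cancel) simp
  also have "\<dots> = - (9 / 8) * (?S * L)"
    using \<open>0 < B\<^sub>W\<close> by (simp add: q2)
  \<comment> \<open>The margin \<open>3 / 2 * q / (1 - \<gamma>)\<close> gives the factor 9/8;
    anything from 1 upwards pays for the vertex pairs.\<close>
  also have "exp (- (9 / 8) * (?S * L)) \<le> exp (?S * - L)"
    using L by simp
  also have "\<dots> = (\<delta> / (2 * ?A + 2)) ^ CARD('s)"
    by (simp only: exp_of_nat_mult exp_L)
  \<comment> \<open>Per state, one factor \<open>exp (- L)\<close> cancels the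
    \<open>2 * ?A + 2\<close> vertex choices and leaves \<open>\<delta>\<close>.\<close>
  also have "(2 * ?A + 2) ^ CARD('s) * \<dots> = \<delta> ^ CARD('s)"
    using A2 by (simp flip: power_mult_distrib)
  also have "\<dots> \<le> \<delta> ^ 1"
    using assms(5,6) S2 by (intro power_decreasing) auto
  finally have bad1: "?prob bad1 \<le> \<delta>"
    by simp

  have "?prob bad2 \<le> 2 ^ CARD('s) * exp (- 2 * real n * (2 * q)\<^sup>2 / (4 * B\<^sub>W)\<^sup>2)"
    unfolding bad2_def using assms q0 by (intro emp_K_deviation) auto
  also have "- 2 * real n * (2 * q)\<^sup>2 / (4 * B\<^sub>W)\<^sup>2 = - (1 / 2) * (real n * q\<^sup>2) / B\<^sub>W\<^sup>2"
    by (simp add: power_mult_distrib)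
  also have "\<dots> = ?S * - (L / 2)"
    using \<open>0 < B\<^sub>W\<close> by (simp add: q2)
  also have "2 ^ CARD('s) * exp (?S * - (L / 2)) = (2 * exp (- (L / 2))) ^ CARD('s)"
    by (simp only: exp_of_nat_mult power_mult_distrib)
  \<comment> \<open>The base is at most 1, so the exponent \<open>CARD('s)\<close> may be lowered to
    2; the square is \<open>4 * exp (- L)\<close>, at most \<open>\<delta>\<close> because
    \<open>2 * ?A + 2\<close> is at least 6.\<close>
  also have "\<dots> \<le> (2 * exp (- (L / 2)))\<^sup>2"
  proof (intro power_decreasing S2)
    have "(2 * exp (- (L / 2)))\<^sup>2 = 4 * exp (- L)"
      by (simp add: power_mult_distrib flip: exp_of_nat_mult)
    also have "\<dots> \<le> 1\<^sup>2"
      using assms(5,6) A2 by (simp add: exp_L field_simps)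
    finally show "2 * exp (- (L / 2)) \<le> 1"
      by (rule power2_le_imp_le) simp
  qed auto
  also have "\<dots> = 4 * exp (- L)"
    by (simp add: power_mult_distrib flip: exp_of_nat_mult)
  also have "\<dots> \<le> \<delta>"
    using assms(5,6) A2 by (simp add: exp_L field_simps)
  finally have bad2: "?prob bad2 \<le> \<delta>" .

  have "?prob bad3 \<le> exp (- 2 * real n * (q / 2)\<^sup>2 / B\<^sub>W\<^sup>2)"
    unfolding bad3_def using assms q0 by (intro emp_reward_deviation) auto
  also have "- 2 * real n * (q / 2)\<^sup>2 / B\<^sub>W\<^sup>2 = - (1 / 2) * (real n * q\<^sup>2) / B\<^sub>W\<^sup>2"
    by (simp add: power_divide)
  also have "\<dots> = - (?S / 2 * L)"
    using \<open>0 < B\<^sub>W\<close> by (simp add: q2)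
  \<comment> \<open>Two states suffice to make the exponent at least \<open>L\<close>.\<close>
  also have "exp (- (?S / 2 * L)) \<le> exp (- L)"
    using L S2 by simp
  also have "\<dots> \<le> \<delta>"
    using assms(5,6) A2 by (simp add: exp_L field_simps)
  finally have bad3: "?prob bad3 \<le> \<delta>" .

  \<comment> \<open>Deterministic bound outside the failure events\<close>
  have w_opt: "0 \<le> w_opt $ sa" for sa
    using assms(12) by (rule W_set_bounds)
  have K_opt: "K_op P \<gamma> \<mu> w_opt = (1 - \<gamma>) *\<^sub>R pmf_vec \<mu>\<^sub>0"
    using assms(13) by (simp add: population_solution_def is_arg_max_def)
  have J_opt: "J P r \<gamma> \<mu>\<^sub>0 \<pi>_opt = reward_vec r \<mu> \<bullet> w_opt"
    using bellman_flow[OF \<gamma> w_opt, of P r \<mu>]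
    unfolding J_eq_policy_value[OF \<gamma>] K_opt assms(14) .

  have eps: "2 * B\<^sub>W * sqrt (?S * ln ((2 * ?A + 2) / \<delta>)) / sqrt (real n) = 2 * q"
    by (simp add: q_def L_def)
  have bound: "4 * B\<^sub>W * sqrt (?S * ln ((2 * ?A + 2) / \<delta>)) / ((1 - \<gamma>) * sqrt (real n)) = 4 * q / (1 - \<gamma>)"
    by (simp add: q_def L_def mult_ac)

  have total: "3 / 2 * q / d + 2 * q / d + (q / 2) / d = 4 * q / d" for d
    by (simp add: divide_simps)

  have good: "(\<exists>w. empirical_solution \<gamma> \<mu>\<^sub>0 B\<^sub>W \<delta> n D w) \<and>
      (\<forall>w. empirical_solution \<gamma> \<mu>\<^sub>0 B\<^sub>W \<delta> n D w \<longrightarrow>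
         J P r \<gamma> \<mu>\<^sub>0 \<pi>_opt - J P r \<gamma> \<mu>\<^sub>0 (policy_of \<mu> w) \<le> 4 * q / (1 - \<gamma>))"
    if D: "D \<notin> bad1 \<union> bad2 \<union> bad3" for D
  proof (intro conjI allI impI)
    \<comment> \<open>Since \<open>w_opt\<close> satisfies the population constraint exactly,
      avoiding \<open>bad2\<close> makes it feasible for the empirical program.\<close>
    have feas: "l1_norm (emp_K \<gamma> n D w_opt - (1 - \<gamma>) *\<^sub>R pmf_vec \<mu>\<^sub>0) \<le> 2 * q"
      using D by (simp add: bad2_def K_opt)
    then show "\<exists>w. empirical_solution \<gamma> \<mu>\<^sub>0 B\<^sub>W \<delta> n D w"
      using assms(12) eps by (intro ex_empirical_solution) auto
    fix w
    assume "empirical_solution \<gamma> \<mu>\<^sub>0 B\<^sub>W \<delta> n D w"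
    then have w: "w \<in> W_set B\<^sub>W"
      and w_feas: "l1_norm (emp_K \<gamma> n D w - (1 - \<gamma>) *\<^sub>R pmf_vec \<mu>\<^sub>0) \<le> 2 * q"
      and opt: "emp_reward n D w_opt \<le> emp_reward n D w"
      using feas assms(12) unfolding empirical_solution_def is_arg_max_linorder eps by auto
    \<comment> \<open>This \<open>V\<close> depends on the data through \<open>w\<close>, which is
      why \<open>bad1\<close> quantifies over all weights and value vectors.\<close>
    define V where "V = policy_value P r \<gamma> (policy_of \<mu> w)"
    have V: "0 \<le> V $ s" "V $ s \<le> 1 / (1 - \<gamma>)" for s
      unfolding V_def using policy_value_bounds[OF \<gamma>] r by blast+
    have J_w: "J P r \<gamma> \<mu>\<^sub>0 (policy_of \<mu> w) = V \<bullet> ((1 - \<gamma>) *\<^sub>R pmf_vec \<mu>\<^sub>0)"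
      unfolding V_def by (rule J_eq_policy_value[OF \<gamma>])
    have "V \<bullet> K_op P \<gamma> \<mu> w = reward_vec r \<mu> \<bullet> w"
      unfolding V_def using W_set_bounds[OF w] by (intro bellman_flow \<gamma>)
    \<comment> \<open>By \<open>bellman_flow\<close> the population Lagrangian vanishes at
      \<open>(w, V)\<close>, so the empirical one is itself the deviation.\<close>
    then have "emp_reward n D w - V \<bullet> emp_K \<gamma> n D w < 3 / 2 * q / (1 - \<gamma>)"
      using D w V unfolding bad1_def by force
    moreover have "reward_vec r \<mu> \<bullet> w_opt < emp_reward n D w_opt + q / 2"
      using D by (simp add: bad3_def)
    moreover have "V \<bullet> emp_K \<gamma> n D w - V \<bullet> ((1 - \<gamma>) *\<^sub>R pmf_vec \<mu>\<^sub>0) \<le> 2 * q / (1 - \<gamma>)"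
    proof -
      have "V \<bullet> (emp_K \<gamma> n D w - (1 - \<gamma>) *\<^sub>R pmf_vec \<mu>\<^sub>0)
          \<le> 1 / (1 - \<gamma>) * l1_norm (emp_K \<gamma> n D w - (1 - \<gamma>) *\<^sub>R pmf_vec \<mu>\<^sub>0)"
        using V by (intro inner_le_l1_norm) auto
      also have "\<dots> \<le> 1 / (1 - \<gamma>) * (2 * q)"
        using w_feas \<gamma> by (intro mult_left_mono) auto
      finally show ?thesis
        by (simp add: inner_diff_right)
    qed
    moreover have "q / 2 \<le> (q / 2) / (1 - \<gamma>)"
      using q0 \<gamma> by (simp add: field_simps)
    \<comment> \<open>Replace the value of \<open>w_opt\<close> by its empirical reward, pass to
      that of \<open>w\<close> by optimality, then add and subtract
      \<open>V \<bullet> emp_K \<gamma> n D w\<close>.\<close>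
    ultimately show "J P r \<gamma> \<mu>\<^sub>0 \<pi>_opt - J P r \<gamma> \<mu>\<^sub>0 (policy_of \<mu> w) \<le> 4 * q / (1 - \<gamma>)"
      unfolding J_opt J_w using opt total[of "1 - \<gamma>"] by linarith
  qed

  have "?prob (bad1 \<union> bad2 \<union> bad3) \<le> ?prob bad1 + ?prob bad2 + ?prob bad3"
    using measure_Un_le[of "bad1 \<union> bad2" "dataset_pmf P r \<mu> n" bad3]
      measure_Un_le[of bad1 "dataset_pmf P r \<mu> n" bad2] by simp
  \<comment> \<open>The three events cost \<open>3 * \<delta>\<close> in total, within the allowed
    \<open>6 * \<delta>\<close>.\<close>
  then have "1 - 6 * \<delta> \<le> 1 - ?prob (bad1 \<union> bad2 \<union> bad3)"
    using bad1 bad2 bad3 assms(5) by linarith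
  also have "\<dots> = ?prob (- (bad1 \<union> bad2 \<union> bad3))"
    using measure_pmf.prob_compl[of "bad1 \<union> bad2 \<union> bad3" "dataset_pmf P r \<mu> n"]
    by (simp add: Compl_eq_Diff_UNIV)
  also have "\<dots> \<le> ?prob {D. (\<exists>w. empirical_solution \<gamma> \<mu>\<^sub>0 B\<^sub>W \<delta> n D w) \<and>
      (\<forall>w. empirical_solution \<gamma> \<mu>\<^sub>0 B\<^sub>W \<delta> n D w \<longrightarrow>
         J P r \<gamma> \<mu>\<^sub>0 \<pi>_opt - J P r \<gamma> \<mu>\<^sub>0 (policy_of \<mu> w) \<le> 4 * q / (1 - \<gamma>))}"
    using good by (intro measure_pmf.finite_measure_mono) auto
  finally show ?thesis
    unfolding bound .
qed

end
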